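(* Let $X$ be an interval-transitive interval space and $A\subseteq X$ a convex set. Then for all $b,c\in X$: $b\in\mathrm{co}(A\cup\{c\})$ if and only if $\langle A,b,c\rangle$. (That is, the $A$-entailment relation $\vdash_A$ of the closure space of convex sets, defined by $x\vdash_A y$ iff $y\in\mathrm{co}(A\cup\{x\})$, is the reverse of the relation $\langle A,\cdot,\cdot\rangle$.)
   Context: An interval space is a set $X$ with a ternary relation $\langle\cdot,\cdot,\cdot\rangle$ such that: $\langle x,x,a\rangle$ and $\langle a,x,x\rangle$ for all $a,x\in X$; $\langle x,a,z\rangle\Rightarrow\langle z,a,x\rangle$; and $\langle x,y,x\rangle$ implies $y=x$. For $A\subseteq X$ and $b,c\in X$, $\langle A,b,c\rangle$ means there is $a\in A$ with $\langle a,b,c\rangle$. For $a,b\in X$, $[a,b]=\{x\in X:\langle a,x,b\rangle\}$. A set $C\subseteq X$ is convex iff for all $x,y,z$, $\langle x,y,z\rangle$ and $x,z\in C$ imply $y\in C$; $\mathrm{co}(B)$ is the intersection of all convex supersets of $B$. $X$ is interval-transitive iff for all $a,b\in X$ the binary relation $\langle[a,b],\cdot,\cdot\rangle$ on $X$ is transitive.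
   Formalization: The convex set A is additionally assumed nonempty; for A = ∅ the claim fails in every nonempty X, since c ∈ co({c}) but ⟨∅,c,c⟩ is false. *)

theory Defs imports "HOL.Hull" Main begin

locale interval_space =
  fixes X :: "'a set" and T :: "'a \<Rightarrow> 'a \<Rightarrow> 'a \<Rightarrow> bool"
  assumes left_refl: "\<And>a x. \<lbrakk>a \<in> X; x \<in> X\<rbrakk> \<Longrightarrow> T x x a"
    and right_refl: "\<And>a x. \<lbrakk>a \<in> X; x \<in> X\<rbrakk> \<Longrightarrow> T a x x"
    and sym: "\<And>x a z. \<lbrakk>x \<in> X; a \<in> X; z \<in> X; T x a z\<rbrakk> \<Longrightarrow> T z a x"
    and antisym: "\<And>x y. \<lbrakk>x \<in> X; y \<in> X; T x y x\<rbrakk> \<Longrightarrow> y = x"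

definition set_between :: "('a \<Rightarrow> 'a \<Rightarrow> 'a \<Rightarrow> bool) \<Rightarrow> 'a set \<Rightarrow> 'a \<Rightarrow> 'a \<Rightarrow> bool"
  where "set_between T A b c \<longleftrightarrow> (\<exists>a\<in>A. T a b c)"

definition interval :: "'a set \<Rightarrow> ('a \<Rightarrow> 'a \<Rightarrow> 'a \<Rightarrow> bool) \<Rightarrow> 'a \<Rightarrow> 'a \<Rightarrow> 'a set"
  where "interval X T a b = {x \<in> X. T a x b}"

definition interval_convex :: "'a set \<Rightarrow> ('a \<Rightarrow> 'a \<Rightarrow> 'a \<Rightarrow> bool) \<Rightarrow> 'a set \<Rightarrow> bool"
  where "interval_convex X T C \<longleftrightarrow>
    C \<subseteq> X \<and> (\<forall>x\<in>X. \<forall>y\<in>X. \<forall>z\<in>X. T x y z \<longrightarrow> x \<in> C \<longrightarrow> z \<in> C \<longrightarrow> y \<in> C)"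

definition co :: "'a set \<Rightarrow> ('a \<Rightarrow> 'a \<Rightarrow> 'a \<Rightarrow> bool) \<Rightarrow> 'a set \<Rightarrow> 'a set"
  where "co X T B = interval_convex X T hull B"

definition interval_transitive :: "'a set \<Rightarrow> ('a \<Rightarrow> 'a \<Rightarrow> 'a \<Rightarrow> bool) \<Rightarrow> bool"
  where "interval_transitive X T \<longleftrightarrow>
    (\<forall>a\<in>X. \<forall>b\<in>X. transp_on X (set_between T (interval X T a b)))"

definition entails :: "'a set \<Rightarrow> ('a \<Rightarrow> 'a \<Rightarrow> 'a \<Rightarrow> bool) \<Rightarrow> 'a set \<Rightarrow> 'a \<Rightarrow> 'a \<Rightarrow> bool"
  where "entails X T A x y \<longleftrightarrow> y \<in> co X T (A \<union> {x})"

end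

theory Submission imports Defs begin

text \<open>The set of all points between \<open>A\<close> and \<open>c\<close> is convex: if \<open>y\<close> lies between
  \<open>x \<in> [a, c]\<close> and \<open>z \<in> [a', c]\<close>, transitivity over \<open>[a', x]\<close> gives \<open>w \<in> [a', x]\<close> with
  \<open>y \<in> [w, c]\<close>, transitivity over \<open>[a, a']\<close> gives \<open>v \<in> [a, a'] \<subseteq> A\<close> with \<open>w \<in> [v, c]\<close>, and
  transitivity over \<open>[c, c] = {c}\<close> gives \<open>y \<in> [v, c]\<close>.\<close>

text \<open>The two links of the chain \<open>x\<close>, \<open>y\<close>, \<open>z\<close> may be
  witnessed by different points \<open>u\<close>, \<open>v\<close> of the interval; this freedom is
  what the convexity argument exploits.\<close>

lemma interval_transitiveE:
  assumes "interval_transitive X T" "a \<in> X" "b \<in> X" "x \<in> X" "y \<in> X" "z \<in> X"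
    and "u \<in> interval X T a b" "T u x y" "v \<in> interval X T a b" "T v y z"
  obtains w where "w \<in> interval X T a b" "T w x z"
proof -
  have "transp_on X (set_between T (interval X T a b))"
    using assms unfolding interval_transitive_def by blast
  moreover have "set_between T (interval X T a b) x y" "set_between T (interval X T a b) y z"
    using assms unfolding set_between_def by blast+
  ultimately have "set_between T (interval X T a b) x z"
    using assms(4-6) by (blast dest: transp_onD)
  then show thesis
    using that unfolding set_between_def by blast
qed

context interval_space
begin

lemma endpoints_in_interval:
  assumes "a \<in> X" "b \<in> X"
  shows "a \<in> interval X T a b" "b \<in> interval X T a b"
  using assms left_refl right_refl by (auto simp: interval_def)

lemma interval_same:
  assumes "a \<in> X"
  shows "interval X T a a = {a}"
  using assms left_refl antisym by (auto simp: interval_def)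

lemma interval_subset_convex:
  assumes "interval_convex X T A" "a \<in> A" "b \<in> A"
  shows "interval X T a b \<subseteq> A"
  using assms unfolding interval_convex_def interval_def by blast

text \<open>Reversed by \<open>sym\<close>, the hypotheses form a chain \<open>y\<close>,
  \<open>w\<close>, \<open>v\<close> over the base \<open>[c, c]\<close>; as this interval is
  \<open>{c}\<close>, the new witness is \<open>c\<close> itself.\<close>

lemma interval_transitive_point:
  assumes "interval_transitive X T" "v \<in> X" "w \<in> X" "y \<in> X" "c \<in> X"
    and "T v w c" "T w y c"
  shows "T v y c"
proof -
  have c: "c \<in> interval X T c c"
    using assms by (simp add: interval_same)
  have "T c y w" "T c w v"
    using assms sym by blast+
  then obtain d where "d \<in> interval X T c c" "T d y v"
    using interval_transitiveE[OF assms(1,5,5,4,3,2) c _ c] by blast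
  then have "T c y v"
    using assms by (simp add: interval_same)
  then show ?thesis
    using assms sym by blast
qed

lemma interval_convex_set_between:
  assumes trans: "interval_transitive X T" and conv: "interval_convex X T A" and c: "c \<in> X"
  shows "interval_convex X T {b \<in> X. set_between T A b c}"
  unfolding interval_convex_def
proof (intro conjI ballI impI)
  fix x y z
  assume X: "x \<in> X" "y \<in> X" "z \<in> X" and xyz: "T x y z"
    and "x \<in> {b \<in> X. set_between T A b c}" "z \<in> {b \<in> X. set_between T A b c}"
  then obtain a a' where a: "a \<in> A" "T a x c" and a': "a' \<in> A" "T a' z c"
    unfolding set_between_def by blast
  have aX: "a \<in> X" "a' \<in> X"
    using a(1) a'(1) conv unfolding interval_convex_def by blast+
  \<comment> \<open>Chain \<open>y\<close>, \<open>z\<close>, \<open>c\<close>: the endpoint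
    \<open>x\<close> of the base witnesses the first link, the endpoint \<open>a'\<close> the
    second.\<close>
  obtain w where w: "w \<in> interval X T a' x" "T w y c"
    by (rule interval_transitiveE[OF trans aX(2) X(1,2,3) c
          endpoints_in_interval(2)[OF aX(2) X(1)] xyz
          endpoints_in_interval(1)[OF aX(2) X(1)] a'(2)])
  have wX: "w \<in> X" and aw: "T a' w x"
    using w(1) by (auto simp: interval_def)
  \<comment> \<open>Chain \<open>w\<close>, \<open>x\<close>, \<open>c\<close>, with links witnessed
    by \<open>a'\<close> and \<open>a\<close>.\<close>
  obtain v where v: "v \<in> interval X T a a'" "T v w c"
    by (rule interval_transitiveE[OF trans aX wX X(1) c
          endpoints_in_interval(2)[OF aX] aw
          endpoints_in_interval(1)[OF aX] a(2)])
  have vX: "v \<in> X"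
    using v(1) by (simp add: interval_def)
  have "T v y c"
    by (rule interval_transitive_point[OF trans vX wX X(2) c v(2) w(2)])
  moreover have "v \<in> A"
    using interval_subset_convex[OF conv a(1) a'(1)] v(1) by blast
  ultimately show "y \<in> {b \<in> X. set_between T A b c}"
    using X(2) unfolding set_between_def by blast
qed blast

lemma in_co_insert_iff_set_between:
  assumes "interval_transitive X T" "interval_convex X T A" "A \<noteq> {}" "b \<in> X" "c \<in> X"
  shows "b \<in> co X T (A \<union> {c}) \<longleftrightarrow> set_between T A b c"
proof
  have "A \<subseteq> X"
    using assms(2) unfolding interval_convex_def by blast
  \<comment> \<open>Each point of \<open>A\<close> is its own witness; for \<open>c\<close> any
    point of \<open>A\<close> serves. With \<open>A\<close> empty this fails: \<open>c\<close> lies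
    in the hull of \<open>{c}\<close>, but nothing is between the empty set and
    \<open>c\<close>.\<close>
  then have "A \<union> {c} \<subseteq> {b \<in> X. set_between T A b c}"
    using assms(3,5) left_refl right_refl unfolding set_between_def by blast
  then have "co X T (A \<union> {c}) \<subseteq> {b \<in> X. set_between T A b c}"
    unfolding co_def using interval_convex_set_between[OF assms(1,2,5)] by (rule hull_minimal)
  then show "b \<in> co X T (A \<union> {c}) \<Longrightarrow> set_between T A b c"
    by blast
next
  assume "set_between T A b c"
  then obtain a where "a \<in> A" "T a b c"
    unfolding set_between_def by blast
  \<comment> \<open>Every convex superset of \<open>A \<union> {c}\<close> contains \<open>a\<close>
    and \<open>c\<close>, hence \<open>b\<close>.\<close>
  then show "b \<in> co X T (A \<union> {c})"
    using assms(4) unfolding co_def hull_def interval_convex_def by blast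
qed

end

theorem proposition3p3:
  fixes X :: "'a set" and T :: "'a \<Rightarrow> 'a \<Rightarrow> 'a \<Rightarrow> bool" and A :: "'a set"
  assumes "interval_space X T"
    and "interval_transitive X T"
    and "interval_convex X T A"
    and "A \<noteq> {}"
  shows "\<forall>b\<in>X. \<forall>c\<in>X.
    (b \<in> co X T (A \<union> {c}) \<longleftrightarrow> set_between T A b c) \<and>
    (entails X T A c b \<longleftrightarrow> set_between T A b c)"
  unfolding entails_def
  using interval_space.in_co_insert_iff_set_between[OF assms] by blast

end
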